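(* Consider the problem $F^*=\min_{x\in\mathrm{dom}\,\psi}[F(x)=f(x)+\psi(x)]$, where $\psi$ is a closed convex function and $f$ is a convex function which is Q-regular on a convex set $S\supseteq\mathrm{dom}\,\psi$ with parameters $0<\mu\le L$. Let $\{x_k\}_{k\ge0}$ be generated by the Quartic Regularization of Newton Method (described in the context) with a parameter $\gamma\in\left(\frac13,\frac12\right)$ satisfying $$\kappa(\gamma):=(1-2\gamma)-\frac{16}{125}\left(\frac L\mu-1\right)\left(\frac{3\gamma-1}{\gamma}\right)^3\ge0,\qquad \alpha\le\min\left\{\frac{3\gamma-1}{3\gamma+1},\ \left[\frac{\mu}{L(1+2\gamma)}\kappa(\gamma)\right]^{1/3}\right\}$$ for some $\alpha>0$. Then, for all $k\ge0$, we have $$F(x_k)-F^*\le(1-\alpha)^k\,(F(x_0)-F^* ).$$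
   Context: $\mathbb{E}$ is a finite-dimensional real vector space with a general norm $\|\cdot\|$ and dual pairing $\langle\cdot,\cdot\rangle$; $\mathrm{dom}\,\psi\subseteq\mathbb{E}$ is nonempty. A function $f$ with convex open domain $\mathrm{dom}\,f\subseteq\mathbb{E}$ is called quartic regular (Q-regular) on a convex set $S$ with parameters $\mu$ and $L$, $L\ge\mu\ge0$, if $f$ is four times continuously differentiable on $\mathrm{dom}\,f$, $S_{1/2}:=\{x-\frac12(y-x):x,y\in S\}\subseteq\mathrm{dom}\,f$, and $$D^4f(x)[h]^4\ge\mu\|h\|^4\quad\forall h\in\mathbb{E},\ x\in S,\qquad D^4f(x)[h]^4\le L\|h\|^4\quad\forall h\in\mathbb{E},\ x\in S_{1/2}.$$ For $\gamma>0$ put $$\hat\xi_{x,\gamma}(y)=f(x)+\langle\nabla f(x),y-x\rangle+\frac{1+3\gamma}{6\gamma}\langle\nabla^2f(x)(y-x),y-x\rangle+\frac{1+2\gamma}{24}L\|y-x\|^4 .$$ Quartic Regularization of Newton Method for Q-regular functions: choose $x_0\in\mathrm{dom}\,\psi$ and $\gamma>0$; for $k\ge0$ let $x_{k+1}$ be a minimizer over $y\in\mathrm{dom}\,\psi$ of $\hat\xi_{x_k,\gamma}(y)+\psi(y)$. *)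

theory Defs
  imports "HOL-Analysis.Analysis"
begin

definition finite_dim :: "'a::real_vector itself \<Rightarrow> bool" where
  "finite_dim _ \<longleftrightarrow> (\<exists>B::'a set. finite B \<and> span B = UNIV)"

(* Frechet derivative as a map into bounded linear functions, so that it can be iterated.
   Meaningful only where f is differentiable. For real-valued f, deriv1 f x is the gradient:
   the dual space is 'a =>_L real and the dual pairing is function application. *)
definition deriv1 :: "('a::real_normed_vector \<Rightarrow> 'b::real_normed_vector) \<Rightarrow> 'a \<Rightarrow> ('a \<Rightarrow>\<^sub>L 'b)" where
  "deriv1 f x = Blinfun (frechet_derivative f (at x))"

definition deriv2 :: "('a::real_normed_vector \<Rightarrow> 'b::real_normed_vector) \<Rightarrow> 'a \<Rightarrow> ('a \<Rightarrow>\<^sub>L 'a \<Rightarrow>\<^sub>L 'b)" where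
  "deriv2 f = deriv1 (deriv1 f)"

definition deriv3 :: "('a::real_normed_vector \<Rightarrow> 'b::real_normed_vector) \<Rightarrow> 'a \<Rightarrow> ('a \<Rightarrow>\<^sub>L 'a \<Rightarrow>\<^sub>L 'a \<Rightarrow>\<^sub>L 'b)" where
  "deriv3 f = deriv1 (deriv2 f)"

definition deriv4 :: "('a::real_normed_vector \<Rightarrow> 'b::real_normed_vector) \<Rightarrow> 'a \<Rightarrow> ('a \<Rightarrow>\<^sub>L 'a \<Rightarrow>\<^sub>L 'a \<Rightarrow>\<^sub>L 'a \<Rightarrow>\<^sub>L 'b)" where
  "deriv4 f = deriv1 (deriv3 f)"

(* Intended for open U. Continuity of f and of the lower derivatives follows from
   differentiability. *)
definition C4_on :: "('a::real_normed_vector \<Rightarrow> 'b::real_normed_vector) \<Rightarrow> 'a set \<Rightarrow> bool" where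
  "C4_on f U \<longleftrightarrow>
     (\<forall>x\<in>U. f differentiable (at x) \<and> deriv1 f differentiable (at x) \<and>
            deriv2 f differentiable (at x) \<and> deriv3 f differentiable (at x)) \<and>
     continuous_on U (deriv4 f)"

definition half_ext :: "'a::real_vector set \<Rightarrow> 'a set" where
  "half_ext S = {x - (1/2) *\<^sub>R (y - x) | x y. x \<in> S \<and> y \<in> S}"

(* A function on a subset of the space is a pair of its domain and a total function;
   values off the domain are irrelevant. *)
definition Q_regular ::
  "'a::real_normed_vector set \<Rightarrow> ('a \<Rightarrow> real) \<Rightarrow> 'a set \<Rightarrow> real \<Rightarrow> real \<Rightarrow> bool" where
  "Q_regular dom_f f S \<mu> L \<longleftrightarrow>
     open dom_f \<and> convex dom_f \<and> convex S \<and> 0 \<le> \<mu> \<and> \<mu> \<le> L \<and>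
     C4_on f dom_f \<and> half_ext S \<subseteq> dom_f \<and>
     (\<forall>x\<in>S. \<forall>h. deriv4 f x h h h h \<ge> \<mu> * norm h ^ 4) \<and>
     (\<forall>x\<in>half_ext S. \<forall>h. deriv4 f x h h h h \<le> L * norm h ^ 4)"

(* Closed convex function with domain D, i.e. its extension by +infinity off D is
   convex and lower semicontinuous; D itself need not be closed. *)
definition closed_convex_fun :: "'a::real_normed_vector set \<Rightarrow> ('a \<Rightarrow> real) \<Rightarrow> bool" where
  "closed_convex_fun D \<psi> \<longleftrightarrow> convex_on D \<psi> \<and> closed (epigraph D \<psi>)"

definition quartic_model ::
  "('a::real_normed_vector \<Rightarrow> real) \<Rightarrow> real \<Rightarrow> real \<Rightarrow> 'a \<Rightarrow> 'a \<Rightarrow> real" where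
  "quartic_model f L \<gamma> x y =
     f x + deriv1 f x (y - x)
     + (1 + 3 * \<gamma>) / (6 * \<gamma>) * deriv2 f x (y - x) (y - x)
     + (1 + 2 * \<gamma>) / 24 * L * norm (y - x) ^ 4"

definition QRNM ::
  "('a::real_normed_vector \<Rightarrow> real) \<Rightarrow> real \<Rightarrow> 'a set \<Rightarrow> ('a \<Rightarrow> real) \<Rightarrow> real \<Rightarrow> (nat \<Rightarrow> 'a) \<Rightarrow> bool" where
  "QRNM f L dom_\<psi> \<psi> \<gamma> x \<longleftrightarrow>
     \<gamma> > 0 \<and> x 0 \<in> dom_\<psi> \<and>
     (\<forall>k. is_arg_min (\<lambda>y. quartic_model f L \<gamma> (x k) y + \<psi> y) (\<lambda>y. y \<in> dom_\<psi>) (x (Suc k)))"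

definition kappa :: "real \<Rightarrow> real \<Rightarrow> real \<Rightarrow> real" where
  "kappa \<mu> L \<gamma> = (1 - 2 * \<gamma>) - 16 / 125 * (L / \<mu> - 1) * ((3 * \<gamma> - 1) / \<gamma>) ^ 3"

end

theory Submission
  imports Defs
begin

text \<open>
  Everything is read off the restriction \<open>g t = f (x + t *\<^sub>R (y - x))\<close> of \<open>f\<close> to a line through two
  points of \<open>S\<close>; write \<open>g1\<close>, \<open>g2\<close>, \<open>g3\<close>, \<open>g4\<close> for its derivatives.  The set \<open>half_ext S\<close> contains
  this line for \<open>-1/2 \<le> t \<le> 1\<close>, so there \<open>g2 \<ge> 0\<close> by convexity and
  \<open>g4 \<le> M = L * norm (y - x) ^ 4\<close>, and on \<open>[0, 1]\<close> also \<open>g4 \<ge> m = \<mu> * norm (y - x) ^ 4\<close>.  The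
  difficulty is the third derivative in Taylor's formula, which the model omits.  Convexity
  controls it by the second derivative, in both directions: \<open>g2 (-\<gamma>) \<ge> 0\<close> bounds \<open>g3 0\<close> from
  above, and \<open>g2 \<gamma> \<ge> 0\<close> bounds it from below.

  The upper bound makes the quartic model a majorant of \<open>f\<close> on \<open>S\<close> (lemma \<open>le_quartic_model\<close>;
  \<open>half_ext\<close> provides exactly the room for a backward step \<open>\<gamma> \<le> 1/2\<close>).  The lower bound, lemma
  \<open>quartic_lower_bound\<close>, gives
  \<open>g 1 - g 0 - g1 0 \<ge> (3 * \<gamma> - 1) / (6 * \<gamma>) * g2 0 + \<kappa> * m / 24\<close>.
  The hypothesis on \<open>\<alpha>\<close> says that this slack pays for the terms of the model beyond first order at
  the point \<open>x + \<alpha> *\<^sub>R (z - x)\<close>: the quadratic terms require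
  \<open>\<alpha> * (1 + 3 * \<gamma>) \<le> 3 * \<gamma> - 1\<close>, the quartic terms
  \<open>\<alpha> ^ 3 * ((1 + 2 * \<gamma>) * L) \<le> \<mu> * \<kappa>\<close>.  Comparing the minimiser of the model with this trial
  point (lemma \<open>QRNM_step\<close>) yields
  \<open>F (x (Suc k)) \<le> (1 - \<alpha>) * F (x k) + \<alpha> * F z\<close> for every \<open>z\<close> in the domain of \<open>\<psi>\<close>.

  As \<open>z\<close> is arbitrary, a single such inequality already bounds \<open>F\<close> from below, because
  \<open>\<alpha> > 0\<close>.  Hence the infimum is a genuine one, and passing to it in \<open>z\<close> gives the contraction
  by \<open>1 - \<alpha>\<close>.
\<close>

section \<open>Third derivatives of convex functions of one variable\<close>

text \<open>
  Taylor at \<open>0\<close> in direction \<open>-c\<close> turns \<open>g2 (-c) \<ge> 0\<close> into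
  \<open>g3 0 \<le> g2 0 / c + c * M / 2\<close>; this is inserted in the Taylor formula for \<open>g 1\<close>.
\<close>

lemma quartic_upper_bound_1d:
  fixes g g1 g2 g3 g4 :: "real \<Rightarrow> real"
  assumes c: "0 < c"
    and d0: "\<And>t. -c \<le> t \<Longrightarrow> t \<le> 1 \<Longrightarrow> (g has_real_derivative g1 t) (at t)"
    and d1: "\<And>t. -c \<le> t \<Longrightarrow> t \<le> 1 \<Longrightarrow> (g1 has_real_derivative g2 t) (at t)"
    and d2: "\<And>t. -c \<le> t \<Longrightarrow> t \<le> 1 \<Longrightarrow> (g2 has_real_derivative g3 t) (at t)"
    and d3: "\<And>t. -c \<le> t \<Longrightarrow> t \<le> 1 \<Longrightarrow> (g3 has_real_derivative g4 t) (at t)"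
    and ub: "\<And>t. -c \<le> t \<Longrightarrow> t \<le> 1 \<Longrightarrow> g4 t \<le> M"
    and nonneg: "0 \<le> g2 (-c)"
  shows "g 1 \<le> g 0 + g1 0 + (1 + 3 * c) / (6 * c) * g2 0 + (1 + 2 * c) / 24 * M"
proof -
  have "\<exists>t>0. t < 1 \<and> g 1 = (\<Sum>m<4. ([g, g1, g2, g3, g4] ! m) 0 / fact m * 1 ^ m)
                              + ([g, g1, g2, g3, g4] ! 4) t / fact 4 * 1 ^ 4"
    by (rule Maclaurin) (use c d0 d1 d2 d3 in \<open>auto simp: less_Suc_eq numeral_eq_Suc\<close>)
  then obtain t where t: "0 < t" "t < 1"
    and gt: "g 1 = g 0 + g1 0 + g2 0 / 2 + g3 0 / 6 + g4 t / 24"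
    by (auto simp: eval_nat_numeral)
  have "\<exists>s>-c. s < 0 \<and> g2 (-c) = (\<Sum>m<2. ([g2, g3, g4] ! m) 0 / fact m * (-c) ^ m)
                              + ([g2, g3, g4] ! 2) s / fact 2 * (-c) ^ 2"
    by (rule Maclaurin_minus) (use c d2 d3 in \<open>auto simp: less_Suc_eq numeral_eq_Suc\<close>)
  then obtain s where s: "-c < s" "s < 0"
    and gs: "g2 (-c) = g2 0 - c * g3 0 + c\<^sup>2 * g4 s / 2"
    by (auto simp: eval_nat_numeral field_simps)
  define e where "e = g2 0 / c + c * M / 2"
  have "c * g3 0 \<le> g2 0 + c\<^sup>2 * M / 2"
  proof -
    have "c\<^sup>2 * g4 s \<le> c\<^sup>2 * M" using ub[of s] s by (intro mult_left_mono) auto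
    then show ?thesis using gs nonneg by linarith
  qed
  then have g3_le: "g3 0 \<le> e"
    using c by (simp add: e_def field_simps power2_eq_square)
  have "g4 t \<le> M" using ub t c by auto
  with g3_le have "g 1 \<le> g 0 + g1 0 + g2 0 / 2 + e / 6 + M / 24"
    using gt by linarith
  also have "\<dots> = g 0 + g1 0 + (1 + 3 * c) / (6 * c) * g2 0 + (1 + 2 * c) / 24 * M"
    using c by (simp add: e_def field_simps)
  finally show ?thesis .
qed

text \<open>
  Taylor's formula for \<open>g 1\<close> has remainder kernel \<open>(1 - t) ^ 3 / 6\<close>, and the one for \<open>g2 c\<close> has
  kernel \<open>c - t\<close> on \<open>[0, c]\<close>.  Subtracting \<open>g2 c / (6 * c)\<close> from \<open>g 1\<close> eliminates \<open>g3 0\<close>, at the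
  price that on \<open>[0, c]\<close> the kernel becomes \<open>K / 6\<close> with \<open>K t = (1 - t) ^ 3 - (1 - t / c)\<close>, which
  is negative for small \<open>t > 0\<close> since \<open>c > 1/3\<close>.  The part \<open>m\<close> of \<open>g4\<close> is integrated exactly and
  contributes \<open>(1 - 2 * c) * m / 24\<close>; only the remainder \<open>g4 - m\<close>, which lies between \<open>0\<close> and
  \<open>M - m\<close>, is estimated against the negative part of \<open>K\<close>.  With \<open>\<delta> = (3 * c - 1) / c\<close> one has
  \<open>K t = - t * (\<delta> - 3 * t + t\<^sup>2) \<ge> - t * (\<delta> - 5/2 * t)\<close> because \<open>t \<le> c < 1/2\<close>, so the loss is
  confined to \<open>[0, 2/5 * \<delta>]\<close> and of order \<open>\<delta> ^ 3\<close>.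

  Each integral is replaced by the monotonicity of a Taylor polynomial whose base point moves: the
  derivative of \<open>g t + (1 - t) * g1 t + (1 - t)\<^sup>2 / 2 * g2 t + (1 - t) ^ 3 / 6 * g3 t\<close> is just the
  kernel times \<open>g4 t\<close>.
\<close>

lemma quartic_lower_bound_1d:
  fixes g g1 g2 g3 g4 :: "real \<Rightarrow> real"
  assumes c: "1/3 < c" "c < 1/2"
    and d0: "\<And>t. 0 \<le> t \<Longrightarrow> t \<le> 1 \<Longrightarrow> (g has_real_derivative g1 t) (at t)"
    and d1: "\<And>t. 0 \<le> t \<Longrightarrow> t \<le> 1 \<Longrightarrow> (g1 has_real_derivative g2 t) (at t)"
    and d2: "\<And>t. 0 \<le> t \<Longrightarrow> t \<le> 1 \<Longrightarrow> (g2 has_real_derivative g3 t) (at t)"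
    and d3: "\<And>t. 0 \<le> t \<Longrightarrow> t \<le> 1 \<Longrightarrow> (g3 has_real_derivative g4 t) (at t)"
    and lb: "\<And>t. 0 \<le> t \<Longrightarrow> t \<le> 1 \<Longrightarrow> m \<le> g4 t"
    and ub: "\<And>t. 0 \<le> t \<Longrightarrow> t \<le> 1 \<Longrightarrow> g4 t \<le> M"
    and nonneg: "0 \<le> g2 c"
  shows "g 0 + g1 0 + (3 * c - 1) / (6 * c) * g2 0
           + ((1 - 2 * c) * m - 16 / 125 * (M - m) * ((3 * c - 1) / c) ^ 3) / 24 \<le> g 1"
proof -
  define \<delta> where "\<delta> = (3 * c - 1) / c"
  define b where "b = 2 / 5 * \<delta>"
  define K where "K = (\<lambda>t. (1 - t) ^ 3 - 1 + t / c)"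
  define P where "P = (\<lambda>t. t * (\<delta> - 5 / 2 * t))"
  define T where "T = (\<lambda>t. g t + (1 - t) * g1 t + (1 - t)\<^sup>2 / 2 * g2 t + (1 - t) ^ 3 / 6 * g3 t)"
  define R where "R = (\<lambda>t. g2 t + (c - t) * g3 t)"
  \<comment> \<open>The last bracket is an antiderivative of \<open>K\<close>, so that \<open>A' = K * (g4 - m) / 6\<close>.\<close>
  define A where "A = (\<lambda>t. T t - R t / (6 * c)
                          - m * (t\<^sup>2 / (2 * c) - t - (1 - t) ^ 4 / 4) / 6)"
  have c0: "0 < c" using c by simp
  have \<delta>: "0 < \<delta>" "inverse c = 3 - \<delta>"
    using c by (auto simp: \<delta>_def field_simps)
  have b: "0 < b" using \<delta> by (simp add: b_def)
  \<comment> \<open>\<open>b < c\<close> amounts to a quadratic in \<open>c\<close> without real roots.\<close>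
  have "0 < (c - 3/5)\<^sup>2 + 1/25" by (simp add: add_nonneg_pos)
  also have "(c - 3/5)\<^sup>2 + 1/25 = c\<^sup>2 - 2/5 * (3 * c - 1)"
    by (simp add: power2_eq_square field_simps)
  also have "\<dots> = c * (c - b)"
    using c0 by (simp add: b_def \<delta>_def field_simps power2_eq_square)
  finally have bc: "b < c" using c0 by (simp add: zero_less_mult_iff)
  have K_eq: "K t = t\<^sup>2 * (1/2 - t) - P t" for t
  proof -
    have "t / c = t * (3 - \<delta>)" using \<delta>(2) by (metis divide_inverse)
    then show ?thesis
      unfolding K_def P_def by (simp add: power2_eq_square power3_eq_cube algebra_simps)
  qed
  have K_lower: "- P t \<le> K t" if "t \<le> c" for t
    using that c unfolding K_eq by simp
  have dT: "(T has_real_derivative (1 - t) ^ 3 / 6 * g4 t) (at t)" if "0 \<le> t" "t \<le> 1" for t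
    unfolding T_def
    by (auto intro!: derivative_eq_intros d0 d1 d2 d3 that
             simp: power2_eq_square power3_eq_cube field_simps)
  have dR: "(R has_real_derivative (c - t) * g4 t) (at t)" if "0 \<le> t" "t \<le> 1" for t
    unfolding R_def
    by (auto intro!: derivative_eq_intros d2 d3 that simp: field_simps)
  have dA: "(A has_real_derivative K t * (g4 t - m) / 6) (at t)" if "0 \<le> t" "t \<le> 1" for t
    unfolding A_def
    using c0 by (auto intro!: derivative_eq_intros dT dR that simp: K_def field_simps)
  \<comment> \<open>Up to \<open>b\<close> the kernel may be negative; the loss is at most \<open>(M - m) / 6\<close> times the integral of \<open>P\<close>
      over \<open>[0, b]\<close>.\<close>
  have first: "A 0 \<le> A b + (M - m) / 6 * (2/75 * \<delta> ^ 3)"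
  proof -
    define B where "B = (\<lambda>t. A t + (M - m) / 6 * (\<delta> * t\<^sup>2 / 2 - 5/6 * t ^ 3))"
    have "B 0 \<le> B b"
    proof (rule DERIV_nonneg_imp_nondecreasing[where f = B])
      show "0 \<le> b" using b by simp
      fix t assume t: "0 \<le> t" "t \<le> b"
      then have t': "0 \<le> t" "t \<le> c" "t \<le> 1" using bc c by auto
      have dB: "(B has_real_derivative K t * (g4 t - m) / 6 + (M - m) / 6 * P t) (at t)"
        unfolding B_def
        by (auto intro!: derivative_eq_intros dA t' simp: P_def power2_eq_square field_simps)
      have P0: "0 \<le> P t" using t by (simp add: P_def b_def)
      have "- (P t * (g4 t - m)) \<le> K t * (g4 t - m)"
        using mult_right_mono[OF K_lower[OF t'(2)], of "g4 t - m"] lb[OF t'(1,3)] by simp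
      moreover have "P t * (g4 t - m) \<le> P t * (M - m)"
        using P0 ub[OF t'(1,3)] by (intro mult_left_mono) auto
      ultimately have "0 \<le> K t * (g4 t - m) / 6 + (M - m) / 6 * P t"
        by (simp add: field_simps)
      with dB show "\<exists>y. (B has_real_derivative y) (at t) \<and> 0 \<le> y" by blast
    qed
    have "\<delta> * b\<^sup>2 / 2 - 5/6 * b ^ 3 = 2/75 * \<delta> ^ 3"
      by (simp add: b_def power2_eq_square power3_eq_cube)
    then have "B b = A b + (M - m) / 6 * (2/75 * \<delta> ^ 3)"
      unfolding B_def by (simp only:)
    moreover have "B 0 = A 0" by (simp add: B_def)
    ultimately show ?thesis using \<open>B 0 \<le> B b\<close> by simp
  qed
  \<comment> \<open>From \<open>b\<close> on the kernel is nonnegative.\<close>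
  have second: "A b \<le> A c"
  proof (rule DERIV_nonneg_imp_nondecreasing[where f = A])
    show "b \<le> c" using bc by simp
    fix t assume t: "b \<le> t" "t \<le> c"
    then have t': "0 \<le> t" "t \<le> 1" using b c by auto
    have "P t \<le> 0" using t t' by (auto simp: P_def b_def mult_le_0_iff)
    with K_lower[OF t(2)] have "0 \<le> K t" by simp
    then have "0 \<le> K t * (g4 t - m) / 6" using lb[OF t'] by simp
    with dA[OF t'] show "\<exists>y. (A has_real_derivative y) (at t) \<and> 0 \<le> y" by blast
  qed
  \<comment> \<open>From \<open>c\<close> on only the remainder of \<open>g 1\<close> is left, with its nonnegative kernel.\<close>
  have third: "T c + m * (1 - c) ^ 4 / 24 \<le> T 1"
  proof -
    define C where "C = (\<lambda>t. T t + m * (1 - t) ^ 4 / 24)"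
    have "C c \<le> C 1"
    proof (rule DERIV_nonneg_imp_nondecreasing[where f = C])
      show "c \<le> 1" using c by simp
      fix t assume t: "c \<le> t" "t \<le> 1"
      then have t': "0 \<le> t" "t \<le> 1" using c by auto
      have dC: "(C has_real_derivative (1 - t) ^ 3 / 6 * (g4 t - m)) (at t)"
        unfolding C_def
        by (auto intro!: derivative_eq_intros dT t' simp: field_simps)
      have "0 \<le> (1 - t) ^ 3 / 6 * (g4 t - m)" using lb[OF t'] t' by simp
      with dC show "\<exists>y. (C has_real_derivative y) (at t) \<and> 0 \<le> y" by blast
    qed
    then show ?thesis by (simp add: C_def)
  qed
  have A0: "A 0 = g 0 + g1 0 + (3 * c - 1) / (6 * c) * g2 0 + m / 24"
    using c0 by (simp add: A_def T_def R_def field_simps)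
  have Ac: "A c = T c - g2 c / (6 * c) + m * (c / 12) + m * (1 - c) ^ 4 / 24"
    using c0 by (simp add: A_def R_def power2_eq_square field_simps)
  have T1: "T 1 = g 1" by (simp add: T_def)
  have "0 \<le> g2 c / (6 * c)" using nonneg c0 by simp
  \<comment> \<open>Rounding \<open>2/75\<close> up to \<open>4/125\<close> gives the stated constant, as \<open>4/125 / 6 = 16/125 / 24\<close>.\<close>
  moreover have "(M - m) / 6 * (2/75 * \<delta> ^ 3) \<le> (M - m) / 6 * (4/125 * \<delta> ^ 3)"
    using lb[of 0] ub[of 0] \<delta> by (intro mult_left_mono mult_right_mono) auto
  ultimately have "A 0 - m * (c / 12) - (M - m) / 6 * (4/125 * \<delta> ^ 3) \<le> g 1"
    using first second third unfolding Ac T1 by linarith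
  moreover have "((1 - 2 * c) * m - 16 / 125 * (M - m) * \<delta> ^ 3) / 24
      = m / 24 - m * (c / 12) - (M - m) / 6 * (4/125 * \<delta> ^ 3)"
    by (simp add: field_simps)
  ultimately show ?thesis unfolding A0 \<delta>_def[symmetric] by linarith
qed

section \<open>Restriction to lines\<close>

lemma differentiable_imp_has_derivative_deriv1:
  assumes "G differentiable (at p)"
  shows "(G has_derivative blinfun_apply (deriv1 G p)) (at p)"
proof -
  have D: "(G has_derivative frechet_derivative G (at p)) (at p)"
    using assms by (simp add: frechet_derivative_works)
  then have "bounded_linear (frechet_derivative G (at p))"
    by (rule has_derivative_bounded_linear)
  with D show ?thesis by (simp add: deriv1_def bounded_linear_Blinfun_apply)
qed

lemma has_vector_derivative_along_line:
  assumes "G differentiable (at (x + t *\<^sub>R h))"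
  shows "((\<lambda>t. G (x + t *\<^sub>R h)) has_vector_derivative deriv1 G (x + t *\<^sub>R h) h) (at t)"
proof -
  have "((\<lambda>t. x + t *\<^sub>R h) has_derivative (\<lambda>s. s *\<^sub>R h)) (at t)"
    by (auto intro!: derivative_eq_intros)
  from diff_chain_at[OF this differentiable_imp_has_derivative_deriv1[OF assms]]
  show ?thesis
    by (simp add: has_vector_derivative_def o_def blinfun.scaleR_right)
qed

lemmas has_vector_derivative_blinfun_apply =
  bounded_linear.has_vector_derivative[OF blinfun.bounded_linear_left]

lemma C4_on_line_derivatives:
  fixes f :: "'a::real_normed_vector \<Rightarrow> real"
  assumes "C4_on f U" and "x + t *\<^sub>R h \<in> U"
  shows "((\<lambda>t. f (x + t *\<^sub>R h)) has_real_derivative deriv1 f (x + t *\<^sub>R h) h) (at t)"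
    and "((\<lambda>t. deriv1 f (x + t *\<^sub>R h) h) has_real_derivative deriv2 f (x + t *\<^sub>R h) h h) (at t)"
    and "((\<lambda>t. deriv2 f (x + t *\<^sub>R h) h h) has_real_derivative
            deriv3 f (x + t *\<^sub>R h) h h h) (at t)"
    and "((\<lambda>t. deriv3 f (x + t *\<^sub>R h) h h h) has_real_derivative
            deriv4 f (x + t *\<^sub>R h) h h h h) (at t)"
proof -
  have D: "f differentiable (at (x + t *\<^sub>R h))" "deriv1 f differentiable (at (x + t *\<^sub>R h))"
    "deriv2 f differentiable (at (x + t *\<^sub>R h))" "deriv3 f differentiable (at (x + t *\<^sub>R h))"
    using assms by (auto simp: C4_on_def)
  note line = D[THEN has_vector_derivative_along_line]
  show "((\<lambda>t. f (x + t *\<^sub>R h)) has_real_derivative deriv1 f (x + t *\<^sub>R h) h) (at t)"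
    using line(1) by (simp add: has_real_derivative_iff_has_vector_derivative)
  show "((\<lambda>t. deriv1 f (x + t *\<^sub>R h) h) has_real_derivative deriv2 f (x + t *\<^sub>R h) h h) (at t)"
    unfolding has_real_derivative_iff_has_vector_derivative deriv2_def
    by (intro has_vector_derivative_blinfun_apply line)
  show "((\<lambda>t. deriv2 f (x + t *\<^sub>R h) h h) has_real_derivative
            deriv3 f (x + t *\<^sub>R h) h h h) (at t)"
    unfolding has_real_derivative_iff_has_vector_derivative deriv3_def
    by (intro has_vector_derivative_blinfun_apply line)
  show "((\<lambda>t. deriv3 f (x + t *\<^sub>R h) h h h) has_real_derivative
            deriv4 f (x + t *\<^sub>R h) h h h h) (at t)"
    unfolding has_real_derivative_iff_has_vector_derivative deriv4_def
    by (intro has_vector_derivative_blinfun_apply line)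
qed

text \<open>
  Along the line \<open>p + t *\<^sub>R h\<close> the tangent inequalities at two points, added up, say that the
  first derivative is nondecreasing.
\<close>

lemma convex_on_imp_deriv2_nonneg:
  fixes f :: "'a::real_normed_vector \<Rightarrow> real"
  assumes "convex_on U f" "open U" "C4_on f U" "p \<in> U"
  shows "0 \<le> deriv2 f p h h"
proof -
  define I where "I = (\<lambda>t::real. p + t *\<^sub>R h) -` U"
  have "open I"
    unfolding I_def by (rule open_vimage[OF \<open>open U\<close>]) (intro continuous_intros)
  have aff: "p + ((1 - u) * s + u * t) *\<^sub>R h = (1 - u) *\<^sub>R (p + s *\<^sub>R h) + u *\<^sub>R (p + t *\<^sub>R h)"
    for u s t :: real
    by (simp add: algebra_simps)
  have "convex U" using assms(1) by (rule convex_on_imp_convex)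
  then have "convex I"
    unfolding I_def convex_alt by (auto simp: aff)
  have conv: "convex_on I (\<lambda>t. f (p + t *\<^sub>R h))"
    using \<open>convex I\<close> convex_onD[OF assms(1)]
    by (intro convex_onI) (auto simp: I_def aff)
  have tangent: "deriv1 f (p + s *\<^sub>R h) h * (t - s) \<le> f (p + t *\<^sub>R h) - f (p + s *\<^sub>R h)"
    if "s \<in> I" "t \<in> I" for s t
  proof (rule convex_on_imp_above_tangent[OF conv])
    show "connected I" using \<open>convex I\<close> by (rule convex_connected)
    show "s \<in> interior I" using that \<open>open I\<close> by (simp add: interior_open)
    show "((\<lambda>t. f (p + t *\<^sub>R h)) has_field_derivative deriv1 f (p + s *\<^sub>R h) h) (at s within I)"
      using C4_on_line_derivatives(1)[OF assms(3), of p s h] that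
      by (auto simp: I_def intro: has_field_derivative_at_within)
  qed (use that in auto)
  have "mono_on I (\<lambda>t. deriv1 f (p + t *\<^sub>R h) h)"
  proof (rule mono_onI)
    fix s t assume st: "s \<in> I" "t \<in> I" "s \<le> t"
    have "deriv1 f (p + s *\<^sub>R h) h * (t - s) \<le> deriv1 f (p + t *\<^sub>R h) h * (t - s)"
      using tangent[OF st(1,2)] tangent[OF st(2,1)] by (simp add: algebra_simps)
    then show "deriv1 f (p + s *\<^sub>R h) h \<le> deriv1 f (p + t *\<^sub>R h) h"
      using st(3) by (cases "s = t") (auto simp: mult_le_cancel_right)
  qed
  moreover have "((\<lambda>t. deriv1 f (p + t *\<^sub>R h) h) has_real_derivative deriv2 f p h h) (at 0)"
    using C4_on_line_derivatives(2)[OF assms(3), of p 0 h] assms(4) by simp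
  moreover have "0 \<in> interior I" using \<open>open I\<close> assms(4) by (simp add: interior_open I_def)
  ultimately show ?thesis by (rule mono_on_imp_deriv_nonneg)
qed

text \<open>
  A point with parameter \<open>t < 0\<close> is the backward half step away from the point of \<open>S\<close> with
  parameter \<open>-2 * t \<le> 1\<close>.
\<close>

lemma convex_line_in_half_ext:
  assumes "convex S" "x \<in> S" "y \<in> S" "-1/2 \<le> t" "t \<le> 1"
  shows "x + t *\<^sub>R (y - x) \<in> half_ext S"
proof -
  have seg: "x + u *\<^sub>R (y - x) \<in> S" if "0 \<le> u" "u \<le> 1" for u
    using convexD_alt[OF assms(1-3) that] by (simp add: algebra_simps)
  show ?thesis
  proof (cases "0 \<le> t")
    case True
    with seg assms(5) have "x + t *\<^sub>R (y - x) \<in> S" by simp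
    moreover have "p \<in> half_ext S" if "p \<in> S" for p
      using that unfolding half_ext_def by force
    ultimately show ?thesis by blast
  next
    case False
    with assms(4) have "x + (- 2 * t) *\<^sub>R (y - x) \<in> S" by (intro seg) auto
    then have "x - (1/2) *\<^sub>R ((x + (- 2 * t) *\<^sub>R (y - x)) - x) \<in> half_ext S"
      unfolding half_ext_def using assms(2) by blast
    then show ?thesis by simp
  qed
qed

section \<open>Model bounds for quartic regular functions\<close>

context
  fixes f :: "'a::real_normed_vector \<Rightarrow> real" and U S :: "'a set" and \<mu> L :: real
  assumes convex_f: "convex_on U f" and Q: "Q_regular U f S \<mu> L"
begin

lemma Q_regular_line:
  assumes "x \<in> S" "y \<in> S" "-1/2 \<le> t" "t \<le> 1"
  shows "x + t *\<^sub>R (y - x) \<in> U"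
    and "0 \<le> deriv2 f (x + t *\<^sub>R (y - x)) (y - x) (y - x)"
    and "deriv4 f (x + t *\<^sub>R (y - x)) (y - x) (y - x) (y - x) (y - x) \<le> L * norm (y - x) ^ 4"
    and "0 \<le> t \<Longrightarrow>
      \<mu> * norm (y - x) ^ 4 \<le> deriv4 f (x + t *\<^sub>R (y - x)) (y - x) (y - x) (y - x) (y - x)"
proof -
  have S: "convex S" using Q by (simp add: Q_regular_def)
  have half: "x + t *\<^sub>R (y - x) \<in> half_ext S"
    by (rule convex_line_in_half_ext[OF S assms])
  then show U: "x + t *\<^sub>R (y - x) \<in> U"
    using Q by (auto simp: Q_regular_def)
  show "0 \<le> deriv2 f (x + t *\<^sub>R (y - x)) (y - x) (y - x)"
    by (rule convex_on_imp_deriv2_nonneg[OF convex_f _ _ U]) (use Q in \<open>auto simp: Q_regular_def\<close>)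
  show "deriv4 f (x + t *\<^sub>R (y - x)) (y - x) (y - x) (y - x) (y - x) \<le> L * norm (y - x) ^ 4"
    using Q half by (auto simp: Q_regular_def)
  show "\<mu> * norm (y - x) ^ 4 \<le> deriv4 f (x + t *\<^sub>R (y - x)) (y - x) (y - x) (y - x) (y - x)"
    if "0 \<le> t"
  proof -
    have "x + t *\<^sub>R (y - x) \<in> S"
      using convexD_alt[OF S assms(1,2) that assms(4)] by (simp add: algebra_simps)
    then show ?thesis using Q by (auto simp: Q_regular_def)
  qed
qed

lemma le_quartic_model:
  assumes "x \<in> S" "y \<in> S" "0 < \<gamma>" "\<gamma> \<le> 1/2"
  shows "f y \<le> quartic_model f L \<gamma> x y"
proof -
  have C4: "C4_on f U" using Q by (simp add: Q_regular_def)
  note line = Q_regular_line[OF assms(1,2)]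
  note D = C4_on_line_derivatives[OF C4 line(1)]
  have "f (x + 1 *\<^sub>R (y - x)) \<le> f (x + 0 *\<^sub>R (y - x)) + deriv1 f (x + 0 *\<^sub>R (y - x)) (y - x)
      + (1 + 3 * \<gamma>) / (6 * \<gamma>) * deriv2 f (x + 0 *\<^sub>R (y - x)) (y - x) (y - x)
      + (1 + 2 * \<gamma>) / 24 * (L * norm (y - x) ^ 4)"
    by (rule quartic_upper_bound_1d[where g = "\<lambda>t. f (x + t *\<^sub>R (y - x))",
          OF assms(3) D line(3) line(2)])
       (use assms in auto)
  then show ?thesis by (simp add: quartic_model_def)
qed

lemma quartic_lower_bound:
  assumes "x \<in> S" "y \<in> S" "1/3 < \<gamma>" "\<gamma> < 1/2" "0 < \<mu>"
  shows "f x + deriv1 f x (y - x) + (3 * \<gamma> - 1) / (6 * \<gamma>) * deriv2 f x (y - x) (y - x)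
           + \<mu> * kappa \<mu> L \<gamma> / 24 * norm (y - x) ^ 4 \<le> f y"
proof -
  have C4: "C4_on f U" using Q by (simp add: Q_regular_def)
  let ?r = "norm (y - x) ^ 4"
  note line = Q_regular_line[OF assms(1,2)]
  note D = C4_on_line_derivatives[OF C4 line(1)]
  have bound: "f (x + 0 *\<^sub>R (y - x)) + deriv1 f (x + 0 *\<^sub>R (y - x)) (y - x)
      + (3 * \<gamma> - 1) / (6 * \<gamma>) * deriv2 f (x + 0 *\<^sub>R (y - x)) (y - x) (y - x)
      + ((1 - 2 * \<gamma>) * (\<mu> * ?r) - 16 / 125 * (L * ?r - \<mu> * ?r) * ((3 * \<gamma> - 1) / \<gamma>) ^ 3) / 24
      \<le> f (x + 1 *\<^sub>R (y - x))"
    by (rule quartic_lower_bound_1d[where g = "\<lambda>t. f (x + t *\<^sub>R (y - x))",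
          OF assms(3,4) D line(4) line(3) line(2)]) (use assms in auto)
  have slack: "((1 - 2 * \<gamma>) * (\<mu> * ?r)
        - 16 / 125 * (L * ?r - \<mu> * ?r) * ((3 * \<gamma> - 1) / \<gamma>) ^ 3) / 24
      = \<mu> * kappa \<mu> L \<gamma> / 24 * ?r"
  proof -
    have "(1 - 2 * \<gamma>) * (\<mu> * r) - 16 / 125 * (L * r - \<mu> * r) * e
        = \<mu> * ((1 - 2 * \<gamma>) - 16 / 125 * (L / \<mu> - 1) * e) * r" for e r :: real
      using assms(5) by (simp add: field_simps)
    then show ?thesis by (simp add: kappa_def)
  qed
  show ?thesis using bound unfolding slack by simp
qed

text \<open>
  Dividing by \<open>\<alpha>\<close> the increment of the model leaves \<open>\<alpha>\<close> at the quadratic term and \<open>\<alpha> ^ 3\<close> at the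
  quartic term; the two conditions on \<open>\<alpha>\<close> make these coefficients at most those of
  \<open>quartic_lower_bound\<close>.
\<close>

lemma quartic_model_segment_le:
  assumes "x \<in> S" "z \<in> S" "1/3 < \<gamma>" "\<gamma> < 1/2" "0 < \<mu>" "0 < \<alpha>"
    and \<alpha>2: "\<alpha> * (1 + 3 * \<gamma>) \<le> 3 * \<gamma> - 1"
    and \<alpha>4: "\<alpha> ^ 3 * ((1 + 2 * \<gamma>) * L) \<le> \<mu> * kappa \<mu> L \<gamma>"
  shows "quartic_model f L \<gamma> x (x + \<alpha> *\<^sub>R (z - x)) \<le> (1 - \<alpha>) * f x + \<alpha> * f z"
proof -
  let ?h = "z - x"
  let ?q = "deriv2 f x ?h ?h" and ?r = "norm ?h ^ 4"
  have \<gamma>: "0 < \<gamma>" using assms(3) by simp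
  have q: "0 \<le> ?q" using Q_regular_line(2)[OF assms(1,2), of 0] by simp
  have "quartic_model f L \<gamma> x (x + \<alpha> *\<^sub>R ?h)
      = f x + \<alpha> * (deriv1 f x ?h + \<alpha> * (1 + 3 * \<gamma>) / (6 * \<gamma>) * ?q
                    + \<alpha> ^ 3 * ((1 + 2 * \<gamma>) * L) / 24 * ?r)"
  proof -
    have "quartic_model f L \<gamma> x (x + \<alpha> *\<^sub>R ?h)
        = f x + \<alpha> * deriv1 f x ?h + (1 + 3 * \<gamma>) / (6 * \<gamma>) * (\<alpha> * (\<alpha> * ?q))
          + (1 + 2 * \<gamma>) / 24 * L * (\<alpha> ^ 4 * ?r)"
      using \<open>0 < \<alpha>\<close>
      by (simp add: quartic_model_def blinfun.scaleR_right blinfun.scaleR_left power_mult_distrib)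
    moreover have "a + \<alpha> * d + (1 + 3 * \<gamma>) / (6 * \<gamma>) * (\<alpha> * (\<alpha> * q)) + (1 + 2 * \<gamma>) / 24 * L * (\<alpha> ^ 4 * r)
        = a + \<alpha> * (d + \<alpha> * (1 + 3 * \<gamma>) / (6 * \<gamma>) * q + \<alpha> ^ 3 * ((1 + 2 * \<gamma>) * L) / 24 * r)"
      for a d q r :: real
      using \<gamma> by (simp add: power4_eq_xxxx power3_eq_cube field_simps)
    ultimately show ?thesis by simp
  qed
  also have "\<dots> \<le> f x + \<alpha> * (deriv1 f x ?h + (3 * \<gamma> - 1) / (6 * \<gamma>) * ?q
                    + \<mu> * kappa \<mu> L \<gamma> / 24 * ?r)"
    using \<open>0 < \<alpha>\<close> \<gamma> q
    by (intro add_mono mult_left_mono mult_right_mono divide_right_mono \<alpha>2 \<alpha>4) auto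
  also have "\<dots> \<le> f x + \<alpha> * (f z - f x)"
    using quartic_lower_bound[OF assms(1-5)] \<open>0 < \<alpha>\<close> by (intro add_mono mult_left_mono) auto
  finally show ?thesis by (simp add: algebra_simps)
qed

lemma QRNM_step:
  assumes "1/3 < \<gamma>" "\<gamma> < 1/2" "0 < \<mu>" "0 < \<alpha>" "\<alpha> \<le> 1"
    and "\<alpha> * (1 + 3 * \<gamma>) \<le> 3 * \<gamma> - 1" "\<alpha> ^ 3 * ((1 + 2 * \<gamma>) * L) \<le> \<mu> * kappa \<mu> L \<gamma>"
    and \<psi>: "convex_on D \<psi>" and "D \<subseteq> S" and "x \<in> D" "z \<in> D"
    and min: "is_arg_min (\<lambda>y. quartic_model f L \<gamma> x y + \<psi> y) (\<lambda>y. y \<in> D) x'"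
  shows "f x' + \<psi> x' \<le> (1 - \<alpha>) * (f x + \<psi> x) + \<alpha> * (f z + \<psi> z)"
proof -
  define y where "y = x + \<alpha> *\<^sub>R (z - x)"
  have y: "y = (1 - \<alpha>) *\<^sub>R x + \<alpha> *\<^sub>R z" by (simp add: y_def algebra_simps)
  have "y \<in> D"
    unfolding y using convexD_alt[OF convex_on_imp_convex[OF \<psi>]] assms by auto
  have "x' \<in> D" using min by (simp add: is_arg_min_def)
  have "f x' + \<psi> x' \<le> quartic_model f L \<gamma> x x' + \<psi> x'"
    using le_quartic_model[of x x' \<gamma>] assms(1,2,9,10) \<open>x' \<in> D\<close> by auto
  also have "\<dots> \<le> quartic_model f L \<gamma> x y + \<psi> y"
    using min \<open>y \<in> D\<close> by (auto simp: is_arg_min_def not_less)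
  also have "quartic_model f L \<gamma> x y \<le> (1 - \<alpha>) * f x + \<alpha> * f z"
    unfolding y_def using assms by (intro quartic_model_segment_le) auto
  also have "\<psi> y \<le> (1 - \<alpha>) * \<psi> x + \<alpha> * \<psi> z"
    unfolding y using assms by (intro convex_onD[OF \<psi>]) auto
  finally show ?thesis by (simp add: algebra_simps)
qed

end

section \<open>Linear convergence\<close>

text \<open>
  Solving one step for \<open>F z\<close> gives a lower bound \<open>c\<close> of \<open>F\<close> on \<open>D\<close>; the contraction is the
  inequality between \<open>c\<close> and the infimum, rearranged.
\<close>

lemma linear_rate_of_averaged_decrease:
  fixes F :: "'a \<Rightarrow> real"
  assumes "0 < \<alpha>" "\<alpha> \<le> 1" and x: "\<And>k. x k \<in> D"
    and step: "\<And>k z. z \<in> D \<Longrightarrow> F (x (Suc k)) \<le> (1 - \<alpha>) * F (x k) + \<alpha> * F z"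
  shows "F (x k) - (INF y\<in>D. F y) \<le> (1 - \<alpha>) ^ k * (F (x 0) - (INF y\<in>D. F y))"
proof (induction k)
  case 0
  show ?case by simp
next
  case (Suc k)
  define c where "c = (F (x (Suc k)) - (1 - \<alpha>) * F (x k)) / \<alpha>"
  have "c \<le> F z" if "z \<in> D" for z
    using step[OF that, of k] \<open>0 < \<alpha>\<close> by (simp add: c_def field_simps)
  then have "c \<le> (INF y\<in>D. F y)"
    using x by (intro cINF_greatest) auto
  then have "F (x (Suc k)) - (INF y\<in>D. F y) \<le> (1 - \<alpha>) * (F (x k) - (INF y\<in>D. F y))"
    using \<open>0 < \<alpha>\<close> by (simp add: c_def field_simps)
  also have "\<dots> \<le> (1 - \<alpha>) * ((1 - \<alpha>) ^ k * (F (x 0) - (INF y\<in>D. F y)))"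
    using Suc.IH \<open>\<alpha> \<le> 1\<close> by (intro mult_left_mono) auto
  finally show ?case by (simp add: mult.assoc)
qed

theorem theorem7:
  fixes f \<psi> F :: "'a::real_normed_vector \<Rightarrow> real"
    and dom_f dom_\<psi> S :: "'a set"
    and \<mu> L \<gamma> \<alpha> Fstar :: real
    and x :: "nat \<Rightarrow> 'a"
  assumes "finite_dim TYPE('a)"
    and "dom_\<psi> \<noteq> {}"
    and "closed_convex_fun dom_\<psi> \<psi>"
    and "convex_on dom_f f"
    and "Q_regular dom_f f S \<mu> L"
    and "dom_\<psi> \<subseteq> S"
    and "0 < \<mu>" and "\<mu> \<le> L"
    and F_def: "F = (\<lambda>y. f y + \<psi> y)"
    and Fstar_def: "Fstar = (INF y\<in>dom_\<psi>. F y)"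
    and "QRNM f L dom_\<psi> \<psi> \<gamma> x"
    and "1/3 < \<gamma>" and "\<gamma> < 1/2"
    and "kappa \<mu> L \<gamma> \<ge> 0"
    and "\<alpha> > 0"
    and "\<alpha> \<le> min ((3 * \<gamma> - 1) / (3 * \<gamma> + 1))
                 (root 3 (\<mu> / (L * (1 + 2 * \<gamma>)) * kappa \<mu> L \<gamma>))"
  shows "\<forall>k. F (x k) - Fstar \<le> (1 - \<alpha>) ^ k * (F (x 0) - Fstar)"
proof -
  have \<gamma>: "0 < \<gamma>" using \<open>1/3 < \<gamma>\<close> by simp
  have L: "0 < L" using \<open>0 < \<mu>\<close> \<open>\<mu> \<le> L\<close> by simp
  have \<alpha>2: "\<alpha> * (1 + 3 * \<gamma>) \<le> 3 * \<gamma> - 1"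
    using \<open>\<alpha> \<le> min _ _\<close> \<gamma> by (simp add: field_simps)
  have \<alpha>1: "\<alpha> \<le> 1"
  proof -
    have "\<alpha> \<le> (3 * \<gamma> - 1) / (3 * \<gamma> + 1)" using \<open>\<alpha> \<le> min _ _\<close> by simp
    also have "\<dots> \<le> 1" using \<gamma> by simp
    finally show ?thesis .
  qed
  have "\<alpha> \<le> root 3 (\<mu> / (L * (1 + 2 * \<gamma>)) * kappa \<mu> L \<gamma>)"
    using \<open>\<alpha> \<le> min _ _\<close> by simp
  then have "\<alpha> ^ 3 \<le> root 3 (\<mu> / (L * (1 + 2 * \<gamma>)) * kappa \<mu> L \<gamma>) ^ 3"
    using \<open>0 < \<alpha>\<close> by (intro power_mono) auto
  also have "\<dots> = \<mu> * kappa \<mu> L \<gamma> / ((1 + 2 * \<gamma>) * L)"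
    by (simp add: odd_real_root_pow mult.commute)
  finally have \<alpha>4: "\<alpha> ^ 3 * ((1 + 2 * \<gamma>) * L) \<le> \<mu> * kappa \<mu> L \<gamma>"
    using \<gamma> L by (simp add: pos_le_divide_eq)
  have \<psi>: "convex_on dom_\<psi> \<psi>"
    using \<open>closed_convex_fun dom_\<psi> \<psi>\<close> by (simp add: closed_convex_fun_def)
  have min: "is_arg_min (\<lambda>y. quartic_model f L \<gamma> (x k) y + \<psi> y) (\<lambda>y. y \<in> dom_\<psi>) (x (Suc k))" for k
    using \<open>QRNM f L dom_\<psi> \<psi> \<gamma> x\<close> by (simp add: QRNM_def)
  have dom: "x k \<in> dom_\<psi>" for k
    using \<open>QRNM f L dom_\<psi> \<psi> \<gamma> x\<close> by (cases k) (auto simp: QRNM_def is_arg_min_def)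
  have "F (x (Suc k)) \<le> (1 - \<alpha>) * F (x k) + \<alpha> * F z" if "z \<in> dom_\<psi>" for k z
    unfolding F_def
    by (rule QRNM_step[OF \<open>convex_on dom_f f\<close> \<open>Q_regular dom_f f S \<mu> L\<close> \<open>1/3 < \<gamma>\<close> \<open>\<gamma> < 1/2\<close>
          \<open>0 < \<mu>\<close> \<open>0 < \<alpha>\<close> \<alpha>1 \<alpha>2 \<alpha>4 \<psi> \<open>dom_\<psi> \<subseteq> S\<close> dom that min])
  then show ?thesis
    unfolding Fstar_def
    using linear_rate_of_averaged_decrease[of \<alpha> x dom_\<psi> F] \<open>0 < \<alpha>\<close> \<alpha>1 dom by blast
qed

end
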